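(* Let $\Lambda_0$ and $\Lambda_1$ be ordered abelian groups and let $H$ be a group that admits an essentially free (orientation-preserving) affine action on $\Lambda_0$. Let $\Lambda'$ be the subgroup of the Cartesian product $\prod_{\omega\in\Lambda_1}\Lambda_0$ consisting of those elements with well-ordered support, ordered lexicographically. Then the restricted wreath product $H\wr\Lambda_1$ has an essentially free (orientation-preserving) affine action on $\Lambda_1\times\Lambda'$, where $\Lambda_1\times\Lambda'$ carries the lexicographic order (first coordinate most significant).
   Context: An ordered abelian group $\Lambda$ is an additively written abelian group with a translation-invariant linear order; $\mathrm{Aut}^+(\Lambda)$ is the group of order-preserving group automorphisms of $\Lambda$. $\Lambda$ is viewed as a $\Lambda$-metric space (a "linear $\Lambda$-tree") via $d(x,y)=|x-y|=\max\{x-y,y-x\}$. Given a group $G$ and a homomorphism $\alpha:G\to\mathrm{Aut}^+(\Lambda)$, $g\mapsto\alpha_g$, an $\alpha$-affine action of $G$ on $\Lambda$ is an action of $G$ on the set $\Lambda$ with $d(gx,gy)=\alpha_g d(x,y)$ for all $x,y\in\Lambda$, $g\in G$. An affine action is an $\alpha$-affine action for some $\alpha$. All affine actions on $\Lambda$ are assumed to be orientation-preserving, i.e. $x\le y\Rightarrow gx\le gy$ (equivalently, each $g$ acts as $x\mapsto \alpha_g x+\nu_g$ for some $\nu_g\in\Lambda$). An orientation-preserving affine automorphism $g$ of $\Lambda$ is hyperbolic if it fixes no point of $\Lambda$, and rigid if no segment $[\lambda_1,\lambda_2]=\{\mu:\lambda_1\le\mu\le\lambda_2\}$ is mapped properly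 into itself by $g$ or $g^{-1}$; equivalently, if $g^{\epsilon}\lambda>\lambda$ for some $\lambda\in\Lambda$ and $\epsilon=\pm1$, then $g^{\epsilon}\lambda'>\lambda'$ for all $\lambda'\in\Lambda$. An affine action of $G$ on $\Lambda$ is essentially free if every non-trivial $g\in G$ acts as a rigid and hyperbolic automorphism. Lexicographic order on $\Lambda'$: the support of $(\lambda_\omega)_{\omega\in\Lambda_1}$ is $\{\omega:\lambda_\omega\ne 0\}$, and $(\lambda_\omega)<(\mu_\omega)$ iff $\lambda_{\omega_0}<\mu_{\omega_0}$ where $\omega_0=\min\{\omega:\lambda_\omega\neq\mu_\omega\}$; this is a linear order on $\Lambda'$. The restricted wreath product $H\wr\Lambda_1$ is the semidirect product of the group of finitely supported functions $\Lambda_1\to H$ with $\Lambda_1$ acting by translation of the index. *)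

theory Defs
  imports
    "HOL-Algebra.Product_Groups"
    "HOL-Algebra.Group_Action"
    "HOL-Library.Product_Plus"
    "HOL-Library.Product_Lexorder"
begin

section \<open>Affine actions on ordered abelian groups\<close>

text \<open>
  An ordered abelian group is a type of class \<^class>\<open>linordered_ab_group_add\<close>; the trivial group
  is not excluded. Acting groups are groups in the sense of HOL-Algebra.
\<close>

definition lin_dist :: "'l::linordered_ab_group_add \<Rightarrow> 'l \<Rightarrow> 'l" where
  "lin_dist x y = max (x - y) (y - x)"

definition additive_group :: "'a::group_add monoid" where
  "additive_group = \<lparr>carrier = UNIV, mult = (+), one = 0\<rparr>"

definition pos_aut_group :: "('l::linordered_ab_group_add \<Rightarrow> 'l) monoid" where
  "pos_aut_group = AutoGroup additive_group \<lparr>carrier := {f \<in> auto additive_group. mono f}\<rparr>"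

definition twisted_affine_action ::
  "('g, 'm) monoid_scheme \<Rightarrow> ('g \<Rightarrow> 'l \<Rightarrow> 'l) \<Rightarrow> ('g \<Rightarrow> 'l::linordered_ab_group_add \<Rightarrow> 'l) \<Rightarrow> bool"
where
  "twisted_affine_action G \<alpha> \<phi> \<longleftrightarrow>
     \<alpha> \<in> hom G pos_aut_group \<and> group_action G UNIV \<phi> \<and>
     (\<forall>g\<in>carrier G. \<forall>x y. lin_dist (\<phi> g x) (\<phi> g y) = \<alpha> g (lin_dist x y))"

definition affine_action ::
  "('g, 'm) monoid_scheme \<Rightarrow> ('g \<Rightarrow> 'l::linordered_ab_group_add \<Rightarrow> 'l) \<Rightarrow> bool"
where
  "affine_action G \<phi> \<longleftrightarrow> (\<exists>\<alpha>. twisted_affine_action G \<alpha> \<phi>)"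

definition orientation_preserving ::
  "('g, 'm) monoid_scheme \<Rightarrow> ('g \<Rightarrow> 'l::linordered_ab_group_add \<Rightarrow> 'l) \<Rightarrow> bool"
where
  "orientation_preserving G \<phi> \<longleftrightarrow> (\<forall>g\<in>carrier G. mono (\<phi> g))"

definition hyperbolic :: "('l \<Rightarrow> 'l) \<Rightarrow> bool" where
  "hyperbolic f \<longleftrightarrow> \<not> (\<exists>x. f x = x)"

definition rigid :: "('l::linordered_ab_group_add \<Rightarrow> 'l) \<Rightarrow> bool" where
  "rigid f \<longleftrightarrow>
     \<not> (\<exists>a b. f ` {a..b} \<subset> {a..b} \<or> inv_into UNIV f ` {a..b} \<subset> {a..b})"

definition essentially_free_affine_action ::
  "('g, 'm) monoid_scheme \<Rightarrow> ('g \<Rightarrow> 'l::linordered_ab_group_add \<Rightarrow> 'l) \<Rightarrow> bool"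
where
  "essentially_free_affine_action G \<phi> \<longleftrightarrow>
     affine_action G \<phi> \<and> orientation_preserving G \<phi> \<and>
     (\<forall>g\<in>carrier G. g \<noteq> \<one>\<^bsub>G\<^esub> \<longrightarrow> rigid (\<phi> g) \<and> hyperbolic (\<phi> g))"


section \<open>Restricted wreath products\<close>

text \<open>
  In \<open>semidirect_product N K \<theta>\<close>, the group \<open>K\<close> acts on the normal factor \<open>N\<close> from the left
  through \<open>\<theta>\<close>.
\<close>

definition semidirect_product ::
  "('n, 'a) monoid_scheme \<Rightarrow> ('k, 'b) monoid_scheme \<Rightarrow> ('k \<Rightarrow> 'n \<Rightarrow> 'n) \<Rightarrow> ('n \<times> 'k) monoid"
where
  "semidirect_product N K \<theta> =
     \<lparr>carrier = carrier N \<times> carrier K,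
      mult = (\<lambda>(n, k) (n', k'). (n \<otimes>\<^bsub>N\<^esub> \<theta> k n', k \<otimes>\<^bsub>K\<^esub> k')),
      one = (\<one>\<^bsub>N\<^esub>, \<one>\<^bsub>K\<^esub>)\<rparr>"

text \<open>
  The element \<open>s\<close> translates the index by \<open>s\<close>: the value at \<open>w\<close> moves to \<open>w + s\<close>. The library's
  \<^const>\<open>sum_group\<close> is the group of finitely supported functions, here on the whole index type.
\<close>

definition restricted_wreath ::
  "('h, 'm) monoid_scheme \<Rightarrow> (('w::ab_group_add \<Rightarrow> 'h) \<times> 'w) monoid"
where
  "restricted_wreath H =
     semidirect_product (sum_group UNIV (\<lambda>_. H)) additive_group (\<lambda>s f w. f (w - s))"


section \<open>The lexicographically ordered group of families with well-ordered support\<close>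

definition well_ordered_set :: "'w::linorder set \<Rightarrow> bool" where
  "well_ordered_set S \<longleftrightarrow> (\<forall>T\<subseteq>S. T \<noteq> {} \<longrightarrow> (\<exists>m\<in>T. \<forall>t\<in>T. m \<le> t))"

lemma well_ordered_set_empty: "well_ordered_set {}"
  by (simp add: well_ordered_set_def)

lemma well_ordered_set_subset: "well_ordered_set S \<Longrightarrow> T \<subseteq> S \<Longrightarrow> well_ordered_set T"
  unfolding well_ordered_set_def by auto

lemma well_ordered_set_Un:
  fixes S T :: "'w::linorder set"
  assumes S: "well_ordered_set S" and T: "well_ordered_set T"
  shows "well_ordered_set (S \<union> T)"
  unfolding well_ordered_set_def
proof (intro allI impI)
  fix U assume U: "U \<subseteq> S \<union> T" "U \<noteq> {}"
  show "\<exists>m\<in>U. \<forall>t\<in>U. m \<le> t"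
  proof (cases "U \<inter> S = {} \<or> U \<inter> T = {}")
    case True
    then have "U \<subseteq> T \<or> U \<subseteq> S" using U by blast
    then show ?thesis
      using S[unfolded well_ordered_set_def, rule_format, of U]
        T[unfolded well_ordered_set_def, rule_format, of U] U(2) by auto
  next
    case False
    obtain m where m: "m \<in> U \<inter> S" "\<forall>t\<in>U \<inter> S. m \<le> t"
      using S[unfolded well_ordered_set_def, rule_format, of "U \<inter> S"] False by auto
    obtain n where n: "n \<in> U \<inter> T" "\<forall>t\<in>U \<inter> T. n \<le> t"
      using T[unfolded well_ordered_set_def, rule_format, of "U \<inter> T"] False by auto
    have "min m n \<in> U" using m(1) n(1) by (simp add: min_def)
    moreover have "min m n \<le> t" if "t \<in> U" for t
      using that U(1) m(2) n(2) by (auto simp: min_le_iff_disj)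
    ultimately show ?thesis by blast
  qed
qed

text \<open>In \<open>('w, 'a) lex_prod\<close> the index group is \<open>'w\<close> and the coefficient group is \<open>'a\<close>.\<close>

typedef (overloaded) ('w::linorder, 'a::zero) lex_prod =
  "{f :: 'w \<Rightarrow> 'a. well_ordered_set {w. f w \<noteq> 0}}"
  morphisms coord Abs_lex_prod
  by (rule exI[of _ "\<lambda>_. 0"]) (simp add: well_ordered_set_empty)

setup_lifting type_definition_lex_prod

lemma well_ordered_support: "well_ordered_set {w. coord f w \<noteq> 0}"
  using coord[of f] by simp

instantiation lex_prod :: (linorder, ab_group_add) ab_group_add
begin

lift_definition zero_lex_prod :: "('a, 'b) lex_prod" is "\<lambda>_. 0"
  by (simp add: well_ordered_set_empty)

lift_definition plus_lex_prod :: "('a, 'b) lex_prod \<Rightarrow> ('a, 'b) lex_prod \<Rightarrow> ('a, 'b) lex_prod"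
  is "\<lambda>f g w. f w + g w"
  by (rule well_ordered_set_subset, rule well_ordered_set_Un, assumption, assumption) auto

lift_definition minus_lex_prod :: "('a, 'b) lex_prod \<Rightarrow> ('a, 'b) lex_prod \<Rightarrow> ('a, 'b) lex_prod"
  is "\<lambda>f g w. f w - g w"
  by (rule well_ordered_set_subset, rule well_ordered_set_Un, assumption, assumption) auto

lift_definition uminus_lex_prod :: "('a, 'b) lex_prod \<Rightarrow> ('a, 'b) lex_prod"
  is "\<lambda>f w. - f w"
  by simp

instance
  by standard (transfer; simp add: algebra_simps fun_eq_iff)+

end

lemma well_ordered_difference:
  fixes f g :: "('w::linorder, 'a::ab_group_add) lex_prod"
  shows "well_ordered_set {w. coord f w \<noteq> coord g w}"
  using well_ordered_support[of "f - g"] by (simp add: minus_lex_prod.rep_eq)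

lemma ex_first_difference:
  fixes f g :: "('w::linorder, 'a::ab_group_add) lex_prod"
  assumes "f \<noteq> g"
  shows "\<exists>w. coord f w \<noteq> coord g w \<and> (\<forall>v. coord f v \<noteq> coord g v \<longrightarrow> w \<le> v)"
proof -
  have "{w. coord f w \<noteq> coord g w} \<noteq> {}"
    using assms by (auto simp flip: coord_inject)
  then show ?thesis
    using well_ordered_difference[of f g, unfolded well_ordered_set_def, rule_format, OF order_refl]
    by auto
qed

instantiation lex_prod :: (linorder, linordered_ab_group_add) linordered_ab_group_add
begin

text \<open>
  If \<open>f = g\<close> the value of \<open>LEAST\<close> is unspecified, but the comparison of coordinates is then false.
\<close>

definition less_lex_prod :: "('a, 'b) lex_prod \<Rightarrow> ('a, 'b) lex_prod \<Rightarrow> bool" where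
  "f < g \<longleftrightarrow> (let w\<^sub>0 = (LEAST w. coord f w \<noteq> coord g w) in coord f w\<^sub>0 < coord g w\<^sub>0)"

definition less_eq_lex_prod :: "('a, 'b) lex_prod \<Rightarrow> ('a, 'b) lex_prod \<Rightarrow> bool" where
  "f \<le> g \<longleftrightarrow> f < g \<or> f = (g :: ('a, 'b) lex_prod)"

lemma less_lex_prod_iff:
  fixes f g :: "('a, 'b) lex_prod"
  shows "f < g \<longleftrightarrow> (\<exists>w. coord f w < coord g w \<and> (\<forall>v<w. coord f v = coord g v))"
proof
  assume less: "f < g"
  then have "f \<noteq> g" by (auto simp: less_lex_prod_def Let_def)
  then obtain w where w: "coord f w \<noteq> coord g w" "\<forall>v. coord f v \<noteq> coord g v \<longrightarrow> w \<le> v"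
    using ex_first_difference by blast
  then have "(LEAST w. coord f w \<noteq> coord g w) = w" by (intro Least_equality) auto
  with less w show "\<exists>w. coord f w < coord g w \<and> (\<forall>v<w. coord f v = coord g v)"
    by (auto simp: less_lex_prod_def Let_def intro!: exI[of _ w] dest: leD)
next
  assume "\<exists>w. coord f w < coord g w \<and> (\<forall>v<w. coord f v = coord g v)"
  then obtain w where w: "coord f w < coord g w" "\<forall>v<w. coord f v = coord g v" by blast
  then have "(LEAST w. coord f w \<noteq> coord g w) = w"
    by (intro Least_equality) (auto intro: leI)
  with w show "f < g" by (simp add: less_lex_prod_def)
qed

instance
proof
  fix x y z :: "('a, 'b) lex_prod"
  have irrefl: "\<not> u < u" for u :: "('a, 'b) lex_prod"
    by (simp add: less_lex_prod_iff)
  have trans: "u < w" if "u < v" "v < w" for u v w :: "('a, 'b) lex_prod"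
  proof -
    from that obtain i j
      where i: "coord u i < coord v i" "\<forall>k<i. coord u k = coord v k"
        and j: "coord v j < coord w j" "\<forall>k<j. coord v k = coord w k"
      unfolding less_lex_prod_iff by blast
    show ?thesis unfolding less_lex_prod_iff
      by (rule exI[of _ "min i j"])
        (use i j in \<open>cases i j rule: linorder_cases; auto simp: min_def\<close>)
  qed
  show "x < y \<longleftrightarrow> x \<le> y \<and> \<not> y \<le> x"
    using trans[of x y x] irrefl unfolding less_eq_lex_prod_def by auto
  show "x \<le> x" by (simp add: less_eq_lex_prod_def)
  show "x \<le> z" if "x \<le> y" "y \<le> z"
    using that trans[of x y z] unfolding less_eq_lex_prod_def by auto
  show "x = y" if "x \<le> y" "y \<le> x"
    using that trans[of x y x] irrefl[of x] unfolding less_eq_lex_prod_def by auto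
  show "x \<le> y \<or> y \<le> x"
  proof (cases "x = y")
    case False
    then obtain w where "coord x w \<noteq> coord y w" "\<forall>v. coord x v \<noteq> coord y v \<longrightarrow> w \<le> v"
      using ex_first_difference by blast
    then have "x < y \<or> y < x"
      unfolding less_lex_prod_iff by (metis leD linorder_neqE)
    then show ?thesis by (auto simp: less_eq_lex_prod_def)
  qed (simp add: less_eq_lex_prod_def)
  show "z + x \<le> z + y" if "x \<le> y"
    using that by (auto simp: less_eq_lex_prod_def less_lex_prod_iff plus_lex_prod.rep_eq)
qed

end


section \<open>The lexicographic product of two ordered abelian groups\<close>

text \<open>
  The order on pairs is the one of \<^theory>\<open>HOL-Library.Product_Lexorder\<close>, in which the first
  component is the most significant one.
\<close>

instance prod :: (linordered_ab_group_add, linordered_ab_group_add) linordered_ab_group_add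
  by standard (auto simp: less_eq_prod_def)

end

theory Submission
  imports Defs
begin

text \<open>
  The element \<open>(f, s)\<close> of \<open>H \<wr> \<Lambda>\<^sub>1\<close> acts on \<open>\<Lambda>\<^sub>1 \<times> \<Lambda>'\<close> by
  \<open>(t, l) \<mapsto> (t + s, (f w \<cdot> l (w - s))\<^sub>w)\<close>: the translation \<open>s\<close> moves the first coordinate and the
  index of the family, and then \<open>f\<close> acts coordinatewise through the given action of \<open>H\<close>. Since \<open>f\<close>
  has finite support, the new family differs from a translate of \<open>l\<close> in finitely many places only,
  so its support is still well ordered.

  Everything rests on a reformulation. For an order-preserving bijection, being rigid and
  hyperbolic means precisely that all points move strictly in the same direction: if one point
  moved up and another one down, the segment between them would be mapped properly into itself by
  the map or by its inverse. The automorphism \<open>\<alpha>\<^sub>g\<close> can also be eliminated, because it is the linear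
  part \<open>x \<mapsto> g x - g 0\<close>. The lemma \<open>essentially_free_affine_action_iff\<close> combines both remarks.

  With this criterion the action above is easily seen to be essentially free. If \<open>s \<noteq> 0\<close>, all first
  coordinates move in the direction of \<open>s\<close>, and the order on pairs sees nothing else. If \<open>s = 0\<close> and
  \<open>f \<noteq> 1\<close>, let \<open>m\<close> be the least element of the support of \<open>f\<close>. A family keeps its coordinates
  below \<open>m\<close>, and its coordinate at \<open>m\<close> moves in a direction that depends only on \<open>f m\<close>; this
  coordinate decides the lexicographic comparison.
\<close>

section \<open>Essentially free actions without segments and twisting automorphisms\<close>

definition moves_one_way :: "('l::ord \<Rightarrow> 'l) \<Rightarrow> bool" where
  "moves_one_way f \<longleftrightarrow> (\<forall>x. x < f x) \<or> (\<forall>x. f x < x)"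

text \<open>
  If \<open>x\<close> moves up and \<open>y\<close> moves down, then the segment between them is mapped into its own
  interior, by \<open>f\<close> in case \<open>x < y\<close> and by the inverse of \<open>f\<close> in case \<open>y < x\<close>. Conversely, if a
  map takes a nonempty segment into itself, then it does not lower the lower end and does not raise the
  upper end, so neither the map nor its inverse moves all points in the same strict direction.
\<close>

lemma rigid_hyperbolic_iff_moves_one_way:
  fixes f :: "'l::linordered_ab_group_add \<Rightarrow> 'l"
  assumes bij: "bij f" and mono: "mono f"
  shows "rigid f \<and> hyperbolic f \<longleftrightarrow> moves_one_way f"
proof
  assume rh: "rigid f \<and> hyperbolic f"
  then have no_fix: "f x \<noteq> x" for x by (auto simp: hyperbolic_def)
  have proper: "S \<subset> {a..b}" if "S \<subseteq> {a<..<b}" "a < b" for S and a b :: 'l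
  proof -
    have "S \<subseteq> {a..b}" "a \<notin> S" using that(1) by (auto simp: subset_eq)
    moreover have "a \<in> {a..b}" using that(2) by simp
    ultimately show ?thesis by blast
  qed
  have False if up: "x < f x" and down: "f y < y" for x y
  proof (cases x y rule: linorder_cases)
    case less
    have "f ` {x..y} \<subseteq> {x<..<y}"
    proof clarsimp
      fix z assume "x \<le> z" "z \<le> y"
      then have "f x \<le> f z" "f z \<le> f y" by (simp_all add: monoD[OF mono])
      with up down show "x < f z \<and> f z < y" by (meson less_le_trans le_less_trans)
    qed
    then have "f ` {x..y} \<subset> {x..y}" using less by (rule proper)
    with rh show False by (auto simp: rigid_def)
  next
    case greater
    let ?g = "inv_into UNIV f"
    have fg: "f (?g z) = z" for z using bij by (simp add: bij_is_surj surj_f_inv_f)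
    have "?g ` {y..x} \<subseteq> {y<..<x}"
    proof clarsimp
      fix z assume z: "y \<le> z" "z \<le> x"
      have "y < ?g z"
      proof (rule ccontr)
        assume "\<not> y < ?g z"
        then have "z \<le> f y" using monoD[OF mono, of "?g z" y] fg by simp
        with z down show False by simp
      qed
      moreover have "?g z < x"
      proof (rule ccontr)
        assume "\<not> ?g z < x"
        then have "f x \<le> z" using monoD[OF mono, of x "?g z"] fg by simp
        with z up show False by simp
      qed
      ultimately show "y < ?g z \<and> ?g z < x" ..
    qed
    then have "?g ` {y..x} \<subset> {y..x}" using greater by (rule proper)
    with rh show False by (auto simp: rigid_def)
  next
    case equal
    with up down show False by simp
  qed
  then show "moves_one_way f"
    unfolding moves_one_way_def using no_fix by (metis linorder_neqE)
next
  assume one_way: "moves_one_way f"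
  let ?g = "inv_into UNIV f"
  have fg: "f (?g z) = z" for z using bij by (simp add: bij_is_surj surj_f_inv_f)
  have "hyperbolic f"
    using one_way unfolding hyperbolic_def moves_one_way_def by (metis less_irrefl)
  moreover have "rigid f"
    unfolding rigid_def
  proof clarify
    fix a b
    assume contr: "f ` {a..b} \<subset> {a..b} \<or> ?g ` {a..b} \<subset> {a..b}"
    then have "a \<le> b" by auto
    then have ends: "a \<in> {a..b}" "b \<in> {a..b}" by simp_all
    from contr show False
    proof
      assume "f ` {a..b} \<subset> {a..b}"
      then have "f a \<in> {a..b}" "f b \<in> {a..b}" using ends by blast+
      then have "\<not> f a < a" "\<not> b < f b" by (simp_all add: not_less)
      with one_way show False unfolding moves_one_way_def by blast
    next
      assume "?g ` {a..b} \<subset> {a..b}"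
      then have "?g a \<in> {a..b}" "?g b \<in> {a..b}" using ends by blast+
      then have "\<not> ?g a < f (?g a)" "\<not> f (?g b) < ?g b" by (simp_all add: fg not_less)
      with one_way show False unfolding moves_one_way_def by blast
    qed
  qed
  ultimately show "rigid f \<and> hyperbolic f" by simp
qed

text \<open>
  The equation is the additivity of the linear part \<open>x \<mapsto> f x - f 0\<close>, with the constants moved
  to one side.
\<close>

definition affine_map :: "('l::ab_group_add \<Rightarrow> 'l) \<Rightarrow> bool" where
  "affine_map f \<longleftrightarrow> (\<forall>x y. f (x + y) + f 0 = f x + f y)"

lemma lin_dist_ge: "y \<le> x \<Longrightarrow> lin_dist x y = x - y"
  unfolding lin_dist_def by (intro max_absorb1) (simp add: diff_mono)

lemma lin_dist_le: "x \<le> y \<Longrightarrow> lin_dist x y = y - x"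
  unfolding lin_dist_def by (intro max_absorb2) (simp add: diff_mono)

lemma affine_map_lin_dist:
  fixes f :: "'l::linordered_ab_group_add \<Rightarrow> 'l"
  assumes "mono f" "affine_map f"
  shows "lin_dist (f x) (f y) = f (lin_dist x y) - f 0"
proof -
  have diff: "f a - f b = f (a - b) - f 0" for a b
  proof -
    have "f ((a - b) + b) + f 0 = f (a - b) + f b"
      using assms(2) unfolding affine_map_def by blast
    then show ?thesis by (simp add: algebra_simps)
  qed
  show ?thesis
  proof (cases "x \<le> y")
    case True
    then show ?thesis
      using lin_dist_le monoD[OF assms(1) True] diff by metis
  next
    case False
    then have "y \<le> x" by simp
    then show ?thesis
      using lin_dist_ge monoD[OF assms(1) \<open>y \<le> x\<close>] diff by metis
  qed
qed

text \<open>
  On nonnegative \<open>x\<close> the distance from \<open>f x\<close> to \<open>f 0\<close> gives \<open>A x = f x - f 0\<close>; on negative \<open>x\<close>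
  it gives the same after a change of sign, which the additive map \<open>A\<close> respects.
\<close>

lemma affine_map_if_twists_lin_dist:
  fixes f A :: "'l::linordered_ab_group_add \<Rightarrow> 'l"
  assumes mono: "mono f" and add: "\<And>x y. A (x + y) = A x + A y"
    and dist: "\<And>x y. lin_dist (f x) (f y) = A (lin_dist x y)"
  shows "affine_map f"
proof -
  have A0: "A 0 = 0" using add[of 0 0] by simp
  have Aminus: "A (- x) = - A x" for x
    using add[of "- x" x] A0 by (simp add: eq_neg_iff_add_eq_0)
  have shift: "f x = A x + f 0" for x
  proof (cases "0 \<le> x")
    case True
    then show ?thesis
      using dist[of x 0] lin_dist_ge[OF True] lin_dist_ge[OF monoD[OF mono True]]
      by (simp add: algebra_simps)
  next
    case False
    then have "x \<le> 0" by simp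
    then show ?thesis
      using dist[of x 0] lin_dist_le[of x 0] lin_dist_le[OF monoD[OF mono \<open>x \<le> 0\<close>]] Aminus[of x]
      by (simp add: algebra_simps)
  qed
  show ?thesis
    unfolding affine_map_def
  proof (intro allI)
    fix x y
    show "f (x + y) + f 0 = f x + f y"
      using add[of x y] shift[of "x + y"] shift[of x] shift[of y] by (simp add: ac_simps)
  qed
qed

lemma pos_aut_group_carrier_iff:
  "A \<in> carrier pos_aut_group \<longleftrightarrow> (\<forall>x y. A (x + y) = A x + A y) \<and> bij A \<and> mono A"
  by (auto simp: pos_aut_group_def AutoGroup_def auto_def additive_group_def hom_def Bij_def)

lemma pos_aut_group_mult:
  assumes "A \<in> carrier pos_aut_group" "B \<in> carrier pos_aut_group"
  shows "A \<otimes>\<^bsub>pos_aut_group\<^esub> B = A \<circ> B"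
proof -
  have "A \<in> Bij UNIV" "B \<in> Bij UNIV"
    using assms by (auto simp: pos_aut_group_carrier_iff Bij_def)
  then show ?thesis
    by (simp add: pos_aut_group_def AutoGroup_def additive_group_def BijGroup_def
        compose_def comp_def restrict_def)
qed

lemma group_action_UNIV_iff:
  "group_action G UNIV \<phi> \<longleftrightarrow>
     group G \<and> (\<forall>g\<in>carrier G. bij (\<phi> g)) \<and>
     (\<forall>g\<in>carrier G. \<forall>h\<in>carrier G. \<phi> (g \<otimes>\<^bsub>G\<^esub> h) = \<phi> g \<circ> \<phi> h)"
proof -
  have "\<phi> \<in> hom G (BijGroup UNIV) \<longleftrightarrow> (\<forall>g\<in>carrier G. bij (\<phi> g)) \<and>
      (\<forall>g\<in>carrier G. \<forall>h\<in>carrier G. \<phi> (g \<otimes>\<^bsub>G\<^esub> h) = \<phi> g \<circ> \<phi> h)"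
    by (auto simp: hom_def BijGroup_def Bij_def compose_def fun_eq_iff Pi_iff)
  then show ?thesis
    by (simp add: group_action_def group_hom_def group_hom_axioms_def group_BijGroup)
qed

text \<open>
  An essentially free action amounts to an action by monotone affine maps in which every
  nontrivial element has a direction. For the implication from right to left the twisting
  homomorphism has to be produced: it sends \<open>g\<close> to its linear part, which is multiplicative in
  \<open>g\<close> because the linear part of a composition is the composition of the linear parts.
\<close>

theorem essentially_free_affine_action_iff:
  fixes \<phi> :: "'g \<Rightarrow> 'l::linordered_ab_group_add \<Rightarrow> 'l"
  shows "essentially_free_affine_action G \<phi> \<longleftrightarrow>
     group_action G UNIV \<phi> \<and>
     (\<forall>g\<in>carrier G. mono (\<phi> g) \<and> affine_map (\<phi> g) \<and>
        (g \<noteq> \<one>\<^bsub>G\<^esub> \<longrightarrow> moves_one_way (\<phi> g)))"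
    (is "_ \<longleftrightarrow> ?R")
proof
  assume ef: "essentially_free_affine_action G \<phi>"
  then obtain \<alpha> where \<alpha>: "\<alpha> \<in> hom G pos_aut_group" and act: "group_action G UNIV \<phi>"
    and dist: "\<And>g x y. g \<in> carrier G \<Longrightarrow> lin_dist (\<phi> g x) (\<phi> g y) = \<alpha> g (lin_dist x y)"
    by (auto simp: essentially_free_affine_action_def affine_action_def twisted_affine_action_def)
  have "mono (\<phi> g) \<and> affine_map (\<phi> g) \<and> (g \<noteq> \<one>\<^bsub>G\<^esub> \<longrightarrow> moves_one_way (\<phi> g))"
    if g: "g \<in> carrier G" for g
  proof -
    have mono: "mono (\<phi> g)"
      using ef g by (auto simp: essentially_free_affine_action_def orientation_preserving_def)
    have "\<alpha> g \<in> carrier pos_aut_group" using \<alpha> g by (auto simp: hom_def)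
    then have "affine_map (\<phi> g)"
      using affine_map_if_twists_lin_dist[OF mono, of "\<alpha> g"] dist[OF g]
      by (auto simp: pos_aut_group_carrier_iff)
    moreover have "bij (\<phi> g)" using act g by (simp add: group_action_UNIV_iff)
    ultimately show ?thesis
      using ef g mono rigid_hyperbolic_iff_moves_one_way[of "\<phi> g"]
      by (auto simp: essentially_free_affine_action_def)
  qed
  with act show ?R by blast
next
  assume R: ?R
  then have bij: "\<And>g. g \<in> carrier G \<Longrightarrow> bij (\<phi> g)"
    and comp: "\<And>g h. g \<in> carrier G \<Longrightarrow> h \<in> carrier G \<Longrightarrow> \<phi> (g \<otimes>\<^bsub>G\<^esub> h) = \<phi> g \<circ> \<phi> h"
    and mono: "\<And>g. g \<in> carrier G \<Longrightarrow> mono (\<phi> g)"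
    and aff: "\<And>g. g \<in> carrier G \<Longrightarrow> affine_map (\<phi> g)"
    by (auto simp: group_action_UNIV_iff)
  define \<alpha> where "\<alpha> = (\<lambda>g x. \<phi> g x - \<phi> g 0)"
  have \<phi>_eq: "\<phi> g x = \<alpha> g x + \<phi> g 0" for g x by (simp add: \<alpha>_def)
  have add: "\<alpha> g (x + y) = \<alpha> g x + \<alpha> g y" if "g \<in> carrier G" for g x y
  proof -
    have "\<phi> g (x + y) + \<phi> g 0 = \<phi> g x + \<phi> g y"
      using aff[OF that] unfolding affine_map_def by blast
    then show ?thesis by (simp add: \<alpha>_def algebra_simps)
  qed
  have aut: "\<alpha> g \<in> carrier pos_aut_group" if g: "g \<in> carrier G" for g
  proof -
    have "bij (\<lambda>y. y - \<phi> g 0)"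
      by (rule o_bij[of "\<lambda>y. y + \<phi> g 0"]) (auto simp: fun_eq_iff)
    then have "bij (\<alpha> g)"
      using bij_comp[OF bij[OF g]] unfolding \<alpha>_def by (simp add: comp_def)
    then show ?thesis
      using add[OF g] mono[OF g] by (auto simp: pos_aut_group_carrier_iff \<alpha>_def mono_def)
  qed
  have "\<alpha> (g \<otimes>\<^bsub>G\<^esub> h) = \<alpha> g \<circ> \<alpha> h" if g: "g \<in> carrier G" and h: "h \<in> carrier G" for g h
  proof
    fix x
    have "\<alpha> (g \<otimes>\<^bsub>G\<^esub> h) x = \<phi> g (\<alpha> h x + \<phi> h 0) - \<phi> g (\<phi> h 0)"
      using comp[OF g h] by (simp add: \<alpha>_def)
    also have "\<dots> = \<alpha> g (\<alpha> h x)"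
      using add[OF g, of "\<alpha> h x" "\<phi> h 0"] \<phi>_eq[of g] by (metis add_diff_cancel_right' add.assoc)
    finally show "\<alpha> (g \<otimes>\<^bsub>G\<^esub> h) x = (\<alpha> g \<circ> \<alpha> h) x" by simp
  qed
  then have "\<alpha> \<in> hom G pos_aut_group"
    using aut by (auto simp: hom_def pos_aut_group_mult)
  moreover have "lin_dist (\<phi> g x) (\<phi> g y) = \<alpha> g (lin_dist x y)" if "g \<in> carrier G" for g x y
    using affine_map_lin_dist[OF mono aff] that by (simp add: \<alpha>_def)
  ultimately have "twisted_affine_action G \<alpha> \<phi>"
    using R by (auto simp: twisted_affine_action_def)
  then show "essentially_free_affine_action G \<phi>"
    using R bij mono rigid_hyperbolic_iff_moves_one_way
    by (auto simp: essentially_free_affine_action_def affine_action_def orientation_preserving_def)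
qed


section \<open>The restricted wreath product is a group\<close>

lemma group_semidirect_product:
  assumes N: "group N" and K: "group K"
    and hom: "\<And>k. k \<in> carrier K \<Longrightarrow> \<theta> k \<in> hom N N"
    and one: "\<And>n. n \<in> carrier N \<Longrightarrow> \<theta> \<one>\<^bsub>K\<^esub> n = n"
    and mult: "\<And>k k' n. k \<in> carrier K \<Longrightarrow> k' \<in> carrier K \<Longrightarrow> n \<in> carrier N \<Longrightarrow>
      \<theta> (k \<otimes>\<^bsub>K\<^esub> k') n = \<theta> k (\<theta> k' n)"
  shows "group (semidirect_product N K \<theta>)"
proof -
  interpret N: group N by fact
  interpret K: group K by fact
  have cl: "\<theta> k n \<in> carrier N" if "k \<in> carrier K" "n \<in> carrier N" for k n
    using hom[OF that(1)] that(2) by (auto simp: hom_def)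
  have hm: "\<theta> k (n \<otimes>\<^bsub>N\<^esub> n') = \<theta> k n \<otimes>\<^bsub>N\<^esub> \<theta> k n'"
    if "k \<in> carrier K" "n \<in> carrier N" "n' \<in> carrier N" for k n n'
    using hom[OF that(1)] that by (auto simp: hom_def)
  have h1: "\<theta> k \<one>\<^bsub>N\<^esub> = \<one>\<^bsub>N\<^esub>" if "k \<in> carrier K" for k
    using hom_one[OF hom[OF that] N N] .
  show ?thesis
  proof (rule groupI)
    fix x assume "x \<in> carrier (semidirect_product N K \<theta>)"
    then obtain n k where x: "x = (n, k)" "n \<in> carrier N" "k \<in> carrier K"
      by (auto simp: semidirect_product_def)
    let ?y = "(\<theta> (inv\<^bsub>K\<^esub> k) (inv\<^bsub>N\<^esub> n), inv\<^bsub>K\<^esub> k)"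
    have "\<theta> (inv\<^bsub>K\<^esub> k) (inv\<^bsub>N\<^esub> n) \<otimes>\<^bsub>N\<^esub> \<theta> (inv\<^bsub>K\<^esub> k) n = \<one>\<^bsub>N\<^esub>"
      using x hm[of "inv\<^bsub>K\<^esub> k" "inv\<^bsub>N\<^esub> n" n] h1 by simp
    then show "\<exists>y\<in>carrier (semidirect_product N K \<theta>).
        y \<otimes>\<^bsub>semidirect_product N K \<theta>\<^esub> x = \<one>\<^bsub>semidirect_product N K \<theta>\<^esub>"
      using x cl by (intro bexI[of _ ?y]) (auto simp: semidirect_product_def)
  qed (auto simp: semidirect_product_def cl hm one mult N.m_assoc K.m_assoc)
qed

lemma group_additive_group: "group (additive_group :: 'a::group_add monoid)"
  by (rule groupI) (auto simp: additive_group_def add.assoc intro: exI[of _ "- _"] left_minus)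

lemma finite_translated_support:
  fixes s :: "'w::ab_group_add"
  assumes "finite {w. P w}"
  shows "finite {w. P (w - s)}"
proof -
  have "{w. P (w - s)} \<subseteq> (\<lambda>w. w + s) ` {w. P w}"
  proof
    fix w assume "w \<in> {w. P (w - s)}"
    then show "w \<in> (\<lambda>w. w + s) ` {w. P w}"
      by (intro image_eqI[of _ _ "w - s"]) auto
  qed
  with assms show ?thesis by (metis finite_imageI finite_subset)
qed

context
  fixes H :: "('h, 'm) monoid_scheme"
  assumes H: "group H"
begin

lemma carrier_finitely_supported:
  "f \<in> carrier (sum_group UNIV (\<lambda>_. H)) \<longleftrightarrow>
     (\<forall>w. f w \<in> carrier H) \<and> finite {w. f w \<noteq> \<one>\<^bsub>H\<^esub>}"
  using carrier_sum_group[of UNIV "\<lambda>_. H"] H by (auto simp: PiE_iff)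

lemma carrier_restricted_wreath:
  "(f, s) \<in> carrier (restricted_wreath H) \<longleftrightarrow>
     (\<forall>w. f w \<in> carrier H) \<and> finite {w. f w \<noteq> \<one>\<^bsub>H\<^esub>}"
  unfolding restricted_wreath_def semidirect_product_def
  by (simp add: carrier_finitely_supported) (simp add: additive_group_def)

lemma mult_restricted_wreath:
  "(f, s) \<otimes>\<^bsub>restricted_wreath H\<^esub> (f', s') = (\<lambda>w. f w \<otimes>\<^bsub>H\<^esub> f' (w - s), s + s')"
  by (simp add: restricted_wreath_def semidirect_product_def additive_group_def restrict_def)

lemma one_restricted_wreath: "\<one>\<^bsub>restricted_wreath H\<^esub> = (\<lambda>_. \<one>\<^bsub>H\<^esub>, 0)"
  by (simp add: restricted_wreath_def semidirect_product_def additive_group_def restrict_def)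

lemma group_restricted_wreath:
  "group (restricted_wreath H :: (('w::ab_group_add \<Rightarrow> 'h) \<times> 'w) monoid)"
  unfolding restricted_wreath_def
proof (rule group_semidirect_product)
  fix s :: 'w
  show "(\<lambda>f w. f (w - s)) \<in> hom (sum_group UNIV (\<lambda>_. H)) (sum_group UNIV (\<lambda>_. H))"
    by (auto simp: hom_def carrier_finitely_supported fun_eq_iff
        intro: finite_translated_support[where P = "\<lambda>w. _ w \<noteq> \<one>\<^bsub>H\<^esub>"])
next
  fix f :: "'w \<Rightarrow> 'h"
  show "(\<lambda>w. f (w - \<one>\<^bsub>additive_group\<^esub>)) = f" by (simp add: additive_group_def)
  fix s s' :: 'w
  show "(\<lambda>w. f (w - (s \<otimes>\<^bsub>additive_group\<^esub> s'))) = (\<lambda>w. f (w - s - s'))"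
    by (simp add: additive_group_def diff_diff_eq)
qed (simp_all add: H group_additive_group)

end


section \<open>The action of the wreath product\<close>

lemma well_ordered_set_finite:
  assumes "finite (S :: 'w::linorder set)"
  shows "well_ordered_set S"
  unfolding well_ordered_set_def
  using assms by (meson Min_in Min_le finite_subset)

lemma well_ordered_set_translate:
  fixes s :: "'w::linordered_ab_group_add"
  assumes wo: "well_ordered_set {w. P w}"
  shows "well_ordered_set {w. P (w - s)}"
  unfolding well_ordered_set_def
proof (intro allI impI)
  fix T assume T: "T \<subseteq> {w. P (w - s)}" "T \<noteq> {}"
  let ?T = "(\<lambda>w. w - s) ` T"
  have "?T \<subseteq> {w. P w}" "?T \<noteq> {}" using T by auto
  then obtain m where "m \<in> ?T" "\<forall>t\<in>?T. m \<le> t"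
    using wo unfolding well_ordered_set_def by meson
  then obtain m' where "m' \<in> T" "\<forall>t\<in>T. m' - s \<le> t - s" by auto
  then show "\<exists>m\<in>T. \<forall>t\<in>T. m \<le> t" by auto
qed

definition wreath_action ::
  "('h \<Rightarrow> 'l0 \<Rightarrow> 'l0) \<Rightarrow> ('l1 \<Rightarrow> 'h) \<times> 'l1 \<Rightarrow>
     'l1::linordered_ab_group_add \<times> ('l1, 'l0::linordered_ab_group_add) lex_prod \<Rightarrow>
     'l1 \<times> ('l1, 'l0) lex_prod"
where
  "wreath_action \<phi> = (\<lambda>(f, s) (t, l). (t + s, Abs_lex_prod (\<lambda>w. \<phi> (f w) (coord l (w - s)))))"

lemma fst_wreath_action [simp]: "fst (wreath_action \<phi> (f, s) p) = fst p + s"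
  by (simp add: wreath_action_def split: prod.split)

lemma lex_prod_eq_iff: "l = l' \<longleftrightarrow> coord l = coord l'"
  by (simp add: coord_inject)

context
  fixes H :: "('h, 'm) monoid_scheme" and \<phi> :: "'h \<Rightarrow> 'l0::linordered_ab_group_add \<Rightarrow> 'l0"
  assumes ef: "essentially_free_affine_action H \<phi>"
begin

interpretation act: group_action H UNIV \<phi>
  using ef by (simp add: essentially_free_affine_action_iff)

lemma base_action_one: "\<phi> \<one>\<^bsub>H\<^esub> x = x"
  using act.id_eq_one by (metis UNIV_I restrict_apply')

lemma base_action_mult:
  "g \<in> carrier H \<Longrightarrow> h \<in> carrier H \<Longrightarrow> \<phi> (g \<otimes>\<^bsub>H\<^esub> h) x = \<phi> g (\<phi> h x)"
  using act.group_action_axioms by (simp add: group_action_UNIV_iff)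

lemma base_action_strict_mono: "g \<in> carrier H \<Longrightarrow> x < y \<Longrightarrow> \<phi> g x < \<phi> g y"
  using ef act.inj_prop[of g] unfolding essentially_free_affine_action_iff
  by (metis UNIV_I inj_on_def monoD order.strict_iff_order)

text \<open>
  The action on coordinates can turn a zero coordinate into a nonzero one, since an affine map
  need not fix \<open>0\<close>, but it does so on the finite support of \<open>f\<close> only.
\<close>

lemma coord_wreath_action:
  assumes "(f, s) \<in> carrier (restricted_wreath H)"
  shows "coord (snd (wreath_action \<phi> (f, s) p)) w = \<phi> (f w) (coord (snd p) (w - s))"
proof -
  let ?l = "coord (snd p)"
  have fin: "finite {w. f w \<noteq> \<one>\<^bsub>H\<^esub>}"
    using assms act.group_hom by (simp add: carrier_restricted_wreath group_hom_def)
  have "{w. \<phi> (f w) (?l (w - s)) \<noteq> 0} \<subseteq> {w. f w \<noteq> \<one>\<^bsub>H\<^esub>} \<union> {w. ?l (w - s) \<noteq> 0}"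
    using base_action_one by auto
  moreover have "well_ordered_set ({w. f w \<noteq> \<one>\<^bsub>H\<^esub>} \<union> {w. ?l (w - s) \<noteq> 0})"
    by (intro well_ordered_set_Un well_ordered_set_finite fin
        well_ordered_set_translate[where P = "\<lambda>w. ?l w \<noteq> 0"] well_ordered_support)
  ultimately have "well_ordered_set {w. \<phi> (f w) (?l (w - s)) \<noteq> 0}"
    by (rule well_ordered_set_subset[rotated])
  then show ?thesis
    by (cases p) (simp add: wreath_action_def Abs_lex_prod_inverse)
qed

lemma wreath_action_one:
  fixes p :: "'l1::linordered_ab_group_add \<times> ('l1, 'l0) lex_prod"
  shows "wreath_action \<phi> \<one>\<^bsub>restricted_wreath H\<^esub> p = p"
proof -
  have grp: "group H" using act.group_hom by (simp add: group_hom_def)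
  have "\<one>\<^bsub>restricted_wreath H\<^esub> \<in> carrier (restricted_wreath H :: (('l1 \<Rightarrow> 'h) \<times> 'l1) monoid)"
    by (rule monoid.one_closed[OF group.is_monoid[OF group_restricted_wreath[OF grp]]])
  then show ?thesis
    using coord_wreath_action[of "\<lambda>_. \<one>\<^bsub>H\<^esub>" 0 p]
    by (simp add: one_restricted_wreath[OF grp] prod_eq_iff lex_prod_eq_iff fun_eq_iff
        base_action_one)
qed

lemma wreath_action_mult:
  assumes g: "g \<in> carrier (restricted_wreath H)" and h: "h \<in> carrier (restricted_wreath H)"
  shows "wreath_action \<phi> (g \<otimes>\<^bsub>restricted_wreath H\<^esub> h) p =
    wreath_action \<phi> g (wreath_action \<phi> h p)"
proof -
  have grp: "group H" using act.group_hom by (simp add: group_hom_def)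
  obtain f s f' s' where gh: "g = (f, s)" "h = (f', s')" by (metis surj_pair)
  have "g \<otimes>\<^bsub>restricted_wreath H\<^esub> h \<in> carrier (restricted_wreath H)"
    by (rule monoid.m_closed[OF group.is_monoid[OF group_restricted_wreath[OF grp]] g h])
  then have prod_in: "(\<lambda>w. f w \<otimes>\<^bsub>H\<^esub> f' (w - s), s + s') \<in> carrier (restricted_wreath H)"
    by (simp add: gh mult_restricted_wreath[OF grp])
  have "f w \<in> carrier H" "f' w \<in> carrier H" for w
    using g h by (auto simp: gh carrier_restricted_wreath[OF grp])
  then show ?thesis
    using g h prod_in
    by (simp add: gh mult_restricted_wreath[OF grp] prod_eq_iff lex_prod_eq_iff fun_eq_iff
        coord_wreath_action base_action_mult algebra_simps)
qed

lemma wreath_action_mono: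
  fixes g :: "('l1::linordered_ab_group_add \<Rightarrow> 'h) \<times> 'l1"
  assumes g: "g \<in> carrier (restricted_wreath H)"
  shows "mono (wreath_action \<phi> g)"
proof (rule monoI)
  fix p q :: "'l1 \<times> ('l1, 'l0) lex_prod"
  assume le: "p \<le> q"
  obtain f s where gfs: "g = (f, s)" by (metis surj_pair)
  have f: "f w \<in> carrier H" for w
    using g act.group_hom by (auto simp: gfs carrier_restricted_wreath group_hom_def)
  consider "fst p < fst q" | "p = q" | "fst p = fst q" "snd p < snd q"
    using le by (auto simp: less_eq_prod_def le_less prod_eq_iff)
  then show "wreath_action \<phi> g p \<le> wreath_action \<phi> g q"
  proof cases
    case 1
    then show ?thesis by (simp add: gfs less_eq_prod_def)
  next
    case 3
    then obtain w where "coord (snd p) w < coord (snd q) w"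
      "\<forall>v<w. coord (snd p) v = coord (snd q) v"
      by (auto simp: less_lex_prod_iff)
    \<comment> \<open>The translation carries the first place of difference from \<open>w\<close> to \<open>w + s\<close>.\<close>
    then have "snd (wreath_action \<phi> g p) < snd (wreath_action \<phi> g q)"
      using g f unfolding less_lex_prod_iff
      by (intro exI[of _ "w + s"])
        (auto simp: gfs coord_wreath_action less_diff_eq diff_less_eq intro: base_action_strict_mono)
    then show ?thesis using 3 by (simp add: gfs less_eq_prod_def)
  qed simp
qed

lemma wreath_action_affine:
  assumes g: "g \<in> carrier (restricted_wreath H)"
  shows "affine_map (wreath_action \<phi> g)"
  unfolding affine_map_def
proof (intro allI)
  fix p q
  obtain f s where gfs: "g = (f, s)" by (metis surj_pair)
  have "\<phi> (f w) (x + y) + \<phi> (f w) 0 = \<phi> (f w) x + \<phi> (f w) y" for w x y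
    using ef g act.group_hom unfolding essentially_free_affine_action_iff affine_map_def
    by (simp add: gfs carrier_restricted_wreath group_hom_def)
  then show "wreath_action \<phi> g (p + q) + wreath_action \<phi> g 0 =
      wreath_action \<phi> g p + wreath_action \<phi> g q"
    using g
    by (simp add: gfs prod_eq_iff lex_prod_eq_iff fun_eq_iff coord_wreath_action
        plus_lex_prod.rep_eq zero_lex_prod.rep_eq algebra_simps)
qed

text \<open>
  The direction is that of \<open>s\<close> if \<open>s \<noteq> 0\<close>, and otherwise that of \<open>f m\<close> on the coefficient
  group, where \<open>m\<close> is the least point of the support of \<open>f\<close>.
\<close>

lemma wreath_action_moves_one_way:
  assumes g: "g \<in> carrier (restricted_wreath H)" and nontriv: "g \<noteq> \<one>\<^bsub>restricted_wreath H\<^esub>"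
  shows "moves_one_way (wreath_action \<phi> g)"
proof -
  have grp: "group H" using act.group_hom by (simp add: group_hom_def)
  obtain f s where gfs: "g = (f, s)" by (metis surj_pair)
  consider "s > 0" | "s < 0" | "s = 0" by (rule linorder_cases)
  then show ?thesis
  proof cases
    case 3
    let ?S = "{w. f w \<noteq> \<one>\<^bsub>H\<^esub>}"
    have f: "f w \<in> carrier H" "finite ?S" for w
      using g by (auto simp: gfs carrier_restricted_wreath[OF grp])
    have "?S \<noteq> {}" using nontriv 3 by (auto simp: gfs one_restricted_wreath[OF grp])
    define m where "m = Min ?S"
    have below: "f v = \<one>\<^bsub>H\<^esub>" if "v < m" for v
      using Min_le[OF f(2), of v] that by (auto simp: m_def dest: leD)
    have "f m \<noteq> \<one>\<^bsub>H\<^esub>" using Min_in[OF f(2) \<open>?S \<noteq> {}\<close>] by (simp add: m_def)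
    then have "moves_one_way (\<phi> (f m))"
      using ef f(1) by (auto simp: essentially_free_affine_action_iff)
    \<comment> \<open>Below \<open>m\<close> nothing changes, so the direction at \<open>m\<close> decides each comparison.\<close>
    moreover have coords: "coord (snd (wreath_action \<phi> g p)) v = \<phi> (f v) (coord (snd p) v)" for p v
      using g coord_wreath_action[of f s p v] 3 by (simp add: gfs)
    moreover have "coord (snd (wreath_action \<phi> g p)) v = coord (snd p) v" if "v < m" for p v
      using coords below[OF that] by (simp add: base_action_one)
    ultimately have "(\<forall>p. snd p < snd (wreath_action \<phi> g p)) \<or>
        (\<forall>p. snd (wreath_action \<phi> g p) < snd p)"
      unfolding moves_one_way_def less_lex_prod_iff by metis
    then show ?thesis using 3 by (auto simp: moves_one_way_def gfs less_prod_def)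
  qed (auto simp: moves_one_way_def gfs less_prod_def)
qed

theorem wreath_action_essentially_free:
  "essentially_free_affine_action (restricted_wreath H) (wreath_action \<phi>)"
proof -
  have grp: "group H" using act.group_hom by (simp add: group_hom_def)
  let ?G = "restricted_wreath H"
  interpret G: group ?G by (rule group_restricted_wreath[OF grp])
  have "bij (wreath_action \<phi> g)" if g: "g \<in> carrier ?G" for g
    by (rule o_bij[of "wreath_action \<phi> (inv\<^bsub>?G\<^esub> g)"])
      (use g in \<open>simp_all add: fun_eq_iff wreath_action_one flip: wreath_action_mult\<close>)
  then have bij: "\<forall>g\<in>carrier ?G. bij (wreath_action \<phi> g)" by blast
  have "group_action ?G UNIV (wreath_action \<phi>)"
    by (simp add: group_action_UNIV_iff G.is_group bij fun_eq_iff wreath_action_mult)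
  then show ?thesis
    by (simp add: essentially_free_affine_action_iff wreath_action_mono wreath_action_affine
        wreath_action_moves_one_way)
qed

end

theorem theorem0p4:
  fixes H :: "('h, 'm) monoid_scheme"
  assumes "group H"
    and "\<exists>\<phi> :: 'h \<Rightarrow> 'l0::linordered_ab_group_add \<Rightarrow> 'l0. essentially_free_affine_action H \<phi>"
  shows "\<exists>\<psi> :: ('l1::linordered_ab_group_add \<Rightarrow> 'h) \<times> 'l1 \<Rightarrow>
                  'l1 \<times> ('l1, 'l0) lex_prod \<Rightarrow> 'l1 \<times> ('l1, 'l0) lex_prod.
           essentially_free_affine_action (restricted_wreath H) \<psi>"
  using assms(2) wreath_action_essentially_free by blast

end
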